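(* Let $G$ be a finite group acting non-trivially on a finite set $\Omega$ and suppose $RC(G,\Omega)=Ht(G,\Omega)+1$. Then there exist almost independent sets of size $Ht(G,\Omega)+1$ in $\Omega$.
   Context: Groups act on the right; $G$ acts entrywise on $\Omega^m$. For $1\le k\le m$ and $I,J\in\Omega^m$, write $I\sim_k J$ if for all $1\le p_1<\dots<p_k\le m$ there is $g\in G$ with $I_{p_i}^g=J_{p_i}$ for all $i\in\{1,\dots,k\}$. The relational complexity $RC(G,\Omega)$ is the least integer $k\ge 2$ such that for all integers $m\ge k$ and all $I,J\in\Omega^m$, $I\sim_k J$ implies $I\sim_m J$. For $\Delta\subseteq\Omega$ let $G_{(\Delta)}$ be the pointwise stabilizer of $\Delta$. A non-empty set $\Delta\subseteq\Omega$ is independent if $G_{(\Gamma)}\ne G_{(\Delta)}$ for every non-empty proper subset $\Gamma\subset\Delta$ (sets of size $1$ are independent). The height $Ht(G,\Omega)$ is the maximum size of an independent set. A non-empty set $\Delta\subseteq\Omega$ is almost independent if $\Delta$ is not independent but every non-empty proper subset of $\Delta$ is independent. *)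

theory Defs
  imports "HOL-Algebra.Group_Action" "HOL-Library.FuncSet"
begin

(* The locale group_action is for left actions.  A right action of G is a left action of the
   opposite group; \<phi> g x is read as x acted on by g, and right_group_action_mult
   below is the law x^(gh) = (x^g)^h. *)

definition opposite_group :: "('g, 'b) monoid_scheme \<Rightarrow> ('g, 'b) monoid_scheme" where
  "opposite_group G = G\<lparr>mult := \<lambda>g h. h \<otimes>\<^bsub>G\<^esub> g\<rparr>"

definition right_group_action ::
  "('g, 'b) monoid_scheme \<Rightarrow> 'a set \<Rightarrow> ('g \<Rightarrow> 'a \<Rightarrow> 'a) \<Rightarrow> bool" where
  "right_group_action G \<Omega> \<phi> \<longleftrightarrow> group G \<and> group_action (opposite_group G) \<Omega> \<phi>"

lemma right_group_action_mult:
  assumes "right_group_action G \<Omega> \<phi>"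
    and "g \<in> carrier G" "h \<in> carrier G" "x \<in> \<Omega>"
  shows "\<phi> (g \<otimes>\<^bsub>G\<^esub> h) x = \<phi> h (\<phi> g x)"
  using assms group_action.composition_rule[of "opposite_group G" \<Omega> \<phi> x h g]
  by (simp add: right_group_action_def opposite_group_def)

definition nontrivial_action ::
  "('g, 'b) monoid_scheme \<Rightarrow> 'a set \<Rightarrow> ('g \<Rightarrow> 'a \<Rightarrow> 'a) \<Rightarrow> bool" where
  "nontrivial_action G \<Omega> \<phi> \<longleftrightarrow> (\<exists>g\<in>carrier G. \<exists>x\<in>\<Omega>. \<phi> g x \<noteq> x)"

(* m-tuples over \<Omega> are the elements of {1..m} \<rightarrow>\<^sub>E \<Omega>. A strictly increasing
   p : {1..k} \<rightarrow> {1..m} is a choice of indices p_1 < ... < p_k; the relation is only meant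
   for 1 \<le> k \<le> m (for k > m there is no such p). *)

definition k_equivalent ::
  "('g, 'b) monoid_scheme \<Rightarrow> ('g \<Rightarrow> 'a \<Rightarrow> 'a) \<Rightarrow> nat \<Rightarrow> nat \<Rightarrow> (nat \<Rightarrow> 'a) \<Rightarrow> (nat \<Rightarrow> 'a) \<Rightarrow> bool" where
  "k_equivalent G \<phi> m k I J \<longleftrightarrow>
     (\<forall>p. p \<in> {1..k} \<rightarrow> {1..m} \<and> strict_mono_on {1..k} p \<longrightarrow>
        (\<exists>g\<in>carrier G. \<forall>i\<in>{1..k}. \<phi> g (I (p i)) = J (p i)))"

(* For finite \<Omega> the set of admissible k contains max 2 (card \<Omega>), so LEAST is meaningful. *)

definition relational_complexity ::
  "('g, 'b) monoid_scheme \<Rightarrow> 'a set \<Rightarrow> ('g \<Rightarrow> 'a \<Rightarrow> 'a) \<Rightarrow> nat" where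
  "relational_complexity G \<Omega> \<phi> =
     (LEAST k. 2 \<le> k \<and>
        (\<forall>m\<ge>k. \<forall>I\<in>{1..m} \<rightarrow>\<^sub>E \<Omega>. \<forall>J\<in>{1..m} \<rightarrow>\<^sub>E \<Omega>.
           k_equivalent G \<phi> m k I J \<longrightarrow> k_equivalent G \<phi> m m I J))"

definition pointwise_stabilizer ::
  "('g, 'b) monoid_scheme \<Rightarrow> ('g \<Rightarrow> 'a \<Rightarrow> 'a) \<Rightarrow> 'a set \<Rightarrow> 'g set" where
  "pointwise_stabilizer G \<phi> \<Delta> = {g \<in> carrier G. \<forall>x\<in>\<Delta>. \<phi> g x = x}"

definition independent_set ::
  "('g, 'b) monoid_scheme \<Rightarrow> 'a set \<Rightarrow> ('g \<Rightarrow> 'a \<Rightarrow> 'a) \<Rightarrow> 'a set \<Rightarrow> bool" where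
  "independent_set G \<Omega> \<phi> \<Delta> \<longleftrightarrow> \<Delta> \<subseteq> \<Omega> \<and> \<Delta> \<noteq> {} \<and>
     (\<forall>\<Gamma>. \<Gamma> \<subset> \<Delta> \<and> \<Gamma> \<noteq> {} \<longrightarrow>
        pointwise_stabilizer G \<phi> \<Gamma> \<noteq> pointwise_stabilizer G \<phi> \<Delta>)"

definition height ::
  "('g, 'b) monoid_scheme \<Rightarrow> 'a set \<Rightarrow> ('g \<Rightarrow> 'a \<Rightarrow> 'a) \<Rightarrow> nat" where
  "height G \<Omega> \<phi> = Max (card ` {\<Delta>. independent_set G \<Omega> \<phi> \<Delta>})"

definition almost_independent_set ::
  "('g, 'b) monoid_scheme \<Rightarrow> 'a set \<Rightarrow> ('g \<Rightarrow> 'a \<Rightarrow> 'a) \<Rightarrow> 'a set \<Rightarrow> bool" where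
  "almost_independent_set G \<Omega> \<phi> \<Delta> \<longleftrightarrow> \<Delta> \<subseteq> \<Omega> \<and> \<Delta> \<noteq> {} \<and>
     \<not> independent_set G \<Omega> \<phi> \<Delta> \<and>
     (\<forall>\<Gamma>. \<Gamma> \<subset> \<Delta> \<and> \<Gamma> \<noteq> {} \<longrightarrow> independent_set G \<Omega> \<phi> \<Gamma>)"

end

(* If the height h is 1, any two points form an almost independent set.  If h >= 2, then k = h is not
   admissible in the definition of the relational complexity, so there are tuples I, J that are
   h-equivalent but not conjugate.  Let S be a minimal set of indices on which no group element maps
   I to J.  Then |S| > h and I is injective on S.  Every proper subset of D = I(S) is independent:
   if x in D is fixed by the stabilizer of a subset avoiding x and some other point y of D, let a and
   b carry I to J on S away from x and away from y; a b^-1 fixes that subset, hence x, so a carries I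
   to J on all of S, a contradiction.  Hence |D| - 1 <= h < |D|. *)

theory Submission
  imports Defs "HOL-Library.Infinite_Set"
begin

lemma right_group_action_agree:
  assumes act: "right_group_action G \<Omega> \<phi>"
    and g: "g \<in> carrier G" and h: "h \<in> carrier G"
  shows "\<exists>k\<in>carrier G. \<forall>x\<in>\<Omega>. \<phi> k x = x \<longleftrightarrow> \<phi> g x = \<phi> h x"
proof -
  interpret group G
    using act by (simp add: right_group_action_def)
  interpret op: group_action "opposite_group G" \<Omega> \<phi>
    using act by (simp add: right_group_action_def)
  have closed: "\<phi> a x \<in> \<Omega>" if "a \<in> carrier G" "x \<in> \<Omega>" for a x
    using op.element_image[of a x "\<phi> a x"] that by (simp add: opposite_group_def)
  have one: "\<phi> \<one>\<^bsub>G\<^esub> x = x" if "x \<in> \<Omega>" for x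
    using op.id_eq_one that
    by (metis (no_types, lifting) opposite_group_def partial_object.select_convs(1)
        monoid.simps(2) monoid.surjective monoid.update_convs(1) restrict_apply')
  note mult = right_group_action_mult[OF act]
  have "\<phi> (g \<otimes>\<^bsub>G\<^esub> inv\<^bsub>G\<^esub> h) x = x \<longleftrightarrow> \<phi> g x = \<phi> h x" if x: "x \<in> \<Omega>" for x
  proof -
    have "\<phi> (inv\<^bsub>G\<^esub> h) (\<phi> h x) = x"
      using mult[of h "inv\<^bsub>G\<^esub> h" x] h x one by simp
    moreover have "\<phi> h (\<phi> (inv\<^bsub>G\<^esub> h) (\<phi> g x)) = \<phi> g x"
      using mult[of "inv\<^bsub>G\<^esub> h" h "\<phi> g x"] g h x one closed by simp
    ultimately show ?thesis
      using mult[of g "inv\<^bsub>G\<^esub> h" x] g h x by auto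
  qed
  then show ?thesis
    using g h by (intro bexI[of _ "g \<otimes>\<^bsub>G\<^esub> inv\<^bsub>G\<^esub> h"]) auto
qed

lemma k_equivalent_iff:
  assumes "k \<le> m"
  shows "k_equivalent G \<phi> m k I J \<longleftrightarrow>
    (\<forall>S\<subseteq>{1..m}. card S \<le> k \<longrightarrow> (\<exists>g\<in>carrier G. \<forall>i\<in>S. \<phi> g (I i) = J i))"
proof
  assume eq: "k_equivalent G \<phi> m k I J"
  show "\<forall>S\<subseteq>{1..m}. card S \<le> k \<longrightarrow> (\<exists>g\<in>carrier G. \<forall>i\<in>S. \<phi> g (I i) = J i)"
  proof (intro allI impI)
    fix S assume S: "S \<subseteq> {1..m}" "card S \<le> k"
    obtain T where T: "S \<subseteq> T" "T \<subseteq> {1..m}" "card T = k"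
      using exists_subset_between[of S k "{1..m}"] S assms by auto
    then have "finite T"
      using finite_subset by blast
    then obtain q where q: "bij_betw q {..<k} T" "strict_mono_on {..<k} q"
      using ex_bij_betw_strict_mono_card T(3) by metis
    define p where "p = (\<lambda>i. q (i - 1))"
    have "{1..k} = Suc ` {..<k}"
      by (simp add: image_Suc_lessThan)
    then have img: "p ` {1..k} = T"
      using q(1) by (simp add: p_def image_image bij_betw_def)
    have "strict_mono_on {1..k} p"
      unfolding p_def by (rule strict_mono_onI, rule strict_mono_onD[OF q(2)]) auto
    moreover have "p \<in> {1..k} \<rightarrow> {1..m}"
      using T img by auto
    ultimately obtain g where g: "g \<in> carrier G" "\<forall>i\<in>{1..k}. \<phi> g (I (p i)) = J (p i)"
      using eq by (auto simp: k_equivalent_def)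
    have "\<phi> g (I i) = J i" if "i \<in> S" for i
    proof -
      have "i \<in> p ` {1..k}"
        using that T(1) img by blast
      then show ?thesis
        using g(2) by auto
    qed
    then show "\<exists>g\<in>carrier G. \<forall>i\<in>S. \<phi> g (I i) = J i"
      using g(1) by blast
  qed
next
  assume *: "\<forall>S\<subseteq>{1..m}. card S \<le> k \<longrightarrow> (\<exists>g\<in>carrier G. \<forall>i\<in>S. \<phi> g (I i) = J i)"
  show "k_equivalent G \<phi> m k I J"
    unfolding k_equivalent_def
  proof (intro allI impI)
    fix p :: "nat \<Rightarrow> nat"
    assume p: "p \<in> {1..k} \<rightarrow> {1..m} \<and> strict_mono_on {1..k} p"
    have "card (p ` {1..k}) \<le> k"
      using card_image_le[of "{1..k}" p] by simp
    moreover have "p ` {1..k} \<subseteq> {1..m}"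
      using p by blast
    ultimately obtain g where "g \<in> carrier G" "\<forall>i\<in>p ` {1..k}. \<phi> g (I i) = J i"
      using * by blast
    then show "\<exists>g\<in>carrier G. \<forall>i\<in>{1..k}. \<phi> g (I (p i)) = J (p i)"
      by (intro bexI[of _ g]) simp_all
  qed
qed

lemma singleton_independent_set:
  "x \<in> \<Omega> \<Longrightarrow> independent_set G \<Omega> \<phi> {x}"
  by (auto simp: independent_set_def)

lemma card_le_height:
  assumes "finite \<Omega>" "independent_set G \<Omega> \<phi> \<Delta>"
  shows "card \<Delta> \<le> height G \<Omega> \<phi>"
proof -
  have "{\<Delta>. independent_set G \<Omega> \<phi> \<Delta>} \<subseteq> Pow \<Omega>"
    by (auto simp: independent_set_def)
  then have "finite {\<Delta>. independent_set G \<Omega> \<phi> \<Delta>}"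
    using assms(1) finite_subset by blast
  then show ?thesis
    unfolding height_def using assms(2) by (intro Max_ge) auto
qed

lemma almost_independent_of_large_card:
  assumes "finite \<Omega>" "\<Delta> \<subseteq> \<Omega>" "height G \<Omega> \<phi> < card \<Delta>" "2 \<le> card \<Delta>"
    and proper: "\<And>\<Gamma>. \<Gamma> \<subset> \<Delta> \<Longrightarrow> \<Gamma> \<noteq> {} \<Longrightarrow> independent_set G \<Omega> \<phi> \<Gamma>"
  shows "almost_independent_set G \<Omega> \<phi> \<Delta> \<and> card \<Delta> = height G \<Omega> \<phi> + 1"
proof
  have "\<not> independent_set G \<Omega> \<phi> \<Delta>"
    using card_le_height[OF assms(1)] assms(3) by (meson leD)
  then show "almost_independent_set G \<Omega> \<phi> \<Delta>"
    using assms by (auto simp: almost_independent_set_def)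
  obtain x where x: "x \<in> \<Delta>"
    using assms(4) by fastforce
  have card: "card (\<Delta> - {x}) = card \<Delta> - 1"
    using x by simp
  then have "\<Delta> - {x} \<noteq> {}"
    using assms(4) by (metis card.empty diff_is_0_eq not_less_eq_eq numeral_2_eq_2 One_nat_def)
  then have "card (\<Delta> - {x}) \<le> height G \<Omega> \<phi>"
    using proper[of "\<Delta> - {x}"] x by (intro card_le_height[OF assms(1)]) auto
  then show "card \<Delta> = height G \<Omega> \<phi> + 1"
    using card assms(3) by simp
qed

lemma minimal_obstruction:
  assumes act: "right_group_action G \<Omega> \<phi>"
    and I: "\<And>i. i \<in> S \<Longrightarrow> I i \<in> \<Omega>" and "3 \<le> card S"
    and none: "\<not> (\<exists>g\<in>carrier G. \<forall>i\<in>S. \<phi> g (I i) = J i)"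
    and proper: "\<And>T. T \<subset> S \<Longrightarrow> \<exists>g\<in>carrier G. \<forall>i\<in>T. \<phi> g (I i) = J i"
  shows "inj_on I S"
    and "\<And>\<Gamma>. \<Gamma> \<subset> I ` S \<Longrightarrow> \<Gamma> \<noteq> {} \<Longrightarrow> independent_set G \<Omega> \<phi> \<Gamma>"
proof -
  show inj: "inj_on I S"
  proof (rule inj_onI, rule ccontr)
    fix i j assume ij: "i \<in> S" "j \<in> S" "I i = I j" "i \<noteq> j"
    have "card {i, j} < card S"
      using ij assms(3) by simp
    then have "{i, j} \<subset> S"
      using ij by auto
    then have "J i = J j"
      using proper[of "{i, j}"] ij(3) by auto
    moreover obtain g where "g \<in> carrier G" "\<forall>l\<in>S - {j}. \<phi> g (I l) = J l"
      using proper[of "S - {j}"] ij by blast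
    ultimately show False
      using none ij by (metis DiffI singletonD)
  qed
  fix \<Gamma> assume \<Gamma>: "\<Gamma> \<subset> I ` S" "\<Gamma> \<noteq> {}"
  show "independent_set G \<Omega> \<phi> \<Gamma>"
    unfolding independent_set_def
  proof (intro conjI allI impI notI)
    show "\<Gamma> \<subseteq> \<Omega>"
      using \<Gamma> I by auto
    show False if "\<Gamma> = {}"
      using that \<Gamma> by blast
    fix \<Gamma>' assume \<Gamma>': "\<Gamma>' \<subset> \<Gamma> \<and> \<Gamma>' \<noteq> {}"
      and stab: "pointwise_stabilizer G \<phi> \<Gamma>' = pointwise_stabilizer G \<phi> \<Gamma>"
    obtain i where i: "i \<in> S" "I i \<in> \<Gamma>" "I i \<notin> \<Gamma>'"
      using \<Gamma> \<Gamma>' by blast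
    obtain j where j: "j \<in> S" "I j \<notin> \<Gamma>"
      using \<Gamma> by blast
    obtain a where a: "a \<in> carrier G" "\<forall>l\<in>S - {i}. \<phi> a (I l) = J l"
      using proper[of "S - {i}"] i by blast
    obtain b where b: "b \<in> carrier G" "\<forall>l\<in>S - {j}. \<phi> b (I l) = J l"
      using proper[of "S - {j}"] j by blast
    obtain c where c: "c \<in> carrier G" "\<forall>x\<in>\<Omega>. \<phi> c x = x \<longleftrightarrow> \<phi> a x = \<phi> b x"
      using right_group_action_agree[OF act a(1) b(1)] by blast
    have "\<phi> c x = x" if x: "x \<in> \<Gamma>'" for x
    proof -
      obtain l where "l \<in> S" "x = I l"
        using x \<Gamma> \<Gamma>' by blast
      moreover have "l \<noteq> i" "l \<noteq> j"
        using x \<open>x = I l\<close> i j \<Gamma>' by auto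
      ultimately show ?thesis
        using a b c I by simp
    qed
    then have "c \<in> pointwise_stabilizer G \<phi> \<Gamma>"
      using c stab by (auto simp: pointwise_stabilizer_def)
    then have "\<phi> a (I i) = \<phi> b (I i)"
      using c i I by (auto simp: pointwise_stabilizer_def)
    also have "\<dots> = J i"
      using b i j by auto
    finally show False
      using a none by blast
  qed
qed

theorem lemma2p4p4:
  fixes G :: "('g, 'b) monoid_scheme" and \<Omega> :: "'a set" and \<phi> :: "'g \<Rightarrow> 'a \<Rightarrow> 'a"
  assumes "right_group_action G \<Omega> \<phi>"
    and "finite (carrier G)" and "finite \<Omega>"
    and "nontrivial_action G \<Omega> \<phi>"
    and "relational_complexity G \<Omega> \<phi> = height G \<Omega> \<phi> + 1"
  shows "\<exists>\<Delta>\<subseteq>\<Omega>. almost_independent_set G \<Omega> \<phi> \<Delta> \<and> card \<Delta> = height G \<Omega> \<phi> + 1"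
proof -
  let ?h = "height G \<Omega> \<phi>"
  interpret op: group_action "opposite_group G" \<Omega> \<phi>
    using assms(1) by (simp add: right_group_action_def)
  show ?thesis
  proof (cases "2 \<le> ?h")
    case False
    obtain g x where gx: "g \<in> carrier G" "x \<in> \<Omega>" "\<phi> g x \<noteq> x"
      using assms(4) by (auto simp: nontrivial_action_def)
    then have in\<Omega>: "{x, \<phi> g x} \<subseteq> \<Omega>"
      using op.element_image[of g x "\<phi> g x"] by (simp add: opposite_group_def)
    have "independent_set G \<Omega> \<phi> \<Gamma>" if "\<Gamma> \<subset> {x, \<phi> g x}" "\<Gamma> \<noteq> {}" for \<Gamma>
    proof -
      have "\<Gamma> = {x} \<or> \<Gamma> = {\<phi> g x}"
        using that by auto
      then show ?thesis
        using in\<Omega> singleton_independent_set[of _ \<Omega> G \<phi>] by auto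
    qed
    then have "almost_independent_set G \<Omega> \<phi> {x, \<phi> g x} \<and> card {x, \<phi> g x} = ?h + 1"
      using False gx(3) by (intro almost_independent_of_large_card[OF assms(3) in\<Omega>]) auto
    then show ?thesis
      using in\<Omega> by blast
  next
    case True
    have "?h < relational_complexity G \<Omega> \<phi>"
      using assms(5) by simp
    from not_less_Least[OF this[unfolded relational_complexity_def]] True
    obtain m I J where m: "?h \<le> m" and I: "I \<in> {1..m} \<rightarrow>\<^sub>E \<Omega>"
      and eq: "k_equivalent G \<phi> m ?h I J" and neq: "\<not> k_equivalent G \<phi> m m I J"
      by blast
    define bad where
      "bad S \<longleftrightarrow> S \<subseteq> {1..m} \<and> \<not> (\<exists>g\<in>carrier G. \<forall>i\<in>S. \<phi> g (I i) = J i)" for S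
    obtain S0 where "bad S0"
      using neq by (auto simp: k_equivalent_iff bad_def)
    then obtain S where "bad S" and least: "\<And>T. bad T \<Longrightarrow> card S \<le> card T"
      using ex_has_least_nat[of bad S0 card] by blast
    then have S: "S \<subseteq> {1..m}" "\<not> (\<exists>g\<in>carrier G. \<forall>i\<in>S. \<phi> g (I i) = J i)"
      by (simp_all only: bad_def simp_thms)
    have fin: "finite S"
      using S finite_subset by blast
    have card: "?h < card S"
      using eq[unfolded k_equivalent_iff[OF m]] S not_le by metis
    have proper: "\<exists>g\<in>carrier G. \<forall>i\<in>T. \<phi> g (I i) = J i" if "T \<subset> S" for T
    proof -
      have "\<not> bad T"
        using least[of T] psubset_card_mono[OF fin that] by linarith
      moreover have "T \<subseteq> {1..m}"
        using that S(1) by blast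
      ultimately show ?thesis
        by (simp only: bad_def) simp
    qed
    have I\<Omega>: "I i \<in> \<Omega>" if "i \<in> S" for i
      using that I S by blast
    have card3: "3 \<le> card S"
      using card True by simp
    note obstruction = minimal_obstruction[OF assms(1) I\<Omega> card3 S(2) proper]
    have card_image: "card (I ` S) = card S"
      by (rule card_image) (rule obstruction(1))
    have sub: "I ` S \<subseteq> \<Omega>"
      using I\<Omega> by blast
    have "almost_independent_set G \<Omega> \<phi> (I ` S) \<and> card (I ` S) = ?h + 1"
      using card card3 card_image obstruction(2)
      by (intro almost_independent_of_large_card[OF assms(3) sub]) simp_all
    then show ?thesis
      using sub by blast
  qed
qed

end
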